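(* Let $\Gamma$ be the game over simplices defined in the context, and let $\tau>0$ satisfy $\tau\le\min\{1/\delta_f,\,1/\delta_f^2\}$. For each $i\in[N]$, $j\in[n_i]$ and each $x\in\hat{\Delta}^{\tau}$, one has $\nabla l_{i,j}^{\tau}(x)=0$ if and only if $x$ minimizes $l_{i,j}^{\tau}$ over $\hat{\Delta}^{\tau}$, i.e. $l_{i,j}^{\tau}(x)=l_{i,j}^{\tau,*}=0$, where $l_{i,j}^{\tau,*}=\min_{y\in\hat{\Delta}^{\tau}}l_{i,j}^{\tau}(y)$.
   Context: Write $[N]=\{1,\dots,N\}$ and let $n_i\ge 1$ be integers. The game $\Gamma$ has $N$ players. Player $i$ has action set the simplex $\Delta_i=\{x_i=(x_i^1,\dots,x_i^{n_i+1})\in\mathbb{R}_+^{n_i+1}:\sum_{j=1}^{n_i+1}x_i^j=1\}$, and $\Delta=\Delta_1\times\dots\times\Delta_N$. Player $i$ maximizes the utility $f_i:\Delta\to\mathbb{R}$, $f_i(x)=\sum_{k\ne i}x_i^TQ_{ik}x_k+\sum_{j=1}^N r_j^Tx_j$, where $Q_{ik}$ are arbitrary real $(n_i+1)\times(n_k+1)$ matrices and $r_j\in\mathbb{R}^{n_j+1}$. Put $\delta_f=\max_{i\in[N]}(\max_{x\in\Delta}f_i(x)-\min_{x\in\Delta}f_i(x))$ (with $1/0=+\infty$). Let $\Delta_i^t=\{x_i=(x_i^1,\dots,x_i^{n_i})\in\mathbb{R}_+^{n_i}:\sum_{j=1}^{n_i}x_i^j\le 1\}$, $\Delta^t=\prod_{i=1}^N\Delta_i^t$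 (the superscript $t$ stands for "transformed"). For $x\in\Delta^t$, $f_i^t(x)$ is the value of $f_i$ at the lift of $x$ to $\Delta$, obtained by setting $x_k^{n_k+1}=1-\sum_{j=1}^{n_k}x_k^j$ for all $k\in[N]$. Since $f_i$ is affine in each $x_k$ and has no quadratic term in $x_i$, one has $\frac{\partial f_i^t}{\partial x_i^j}(x)=\hat r_i^j+\sum_{k\ne i}\langle\hat q_{ik}^j,x_k\rangle$ for constants $\hat r_i^j\in\mathbb{R}$ and vectors $\hat q_{ik}^j\in\mathbb{R}^{n_k}$ determined by the game. For $i\in[N]$, $j\in[n_i]$ define $$l_{i,j}^{\tau}(x)=\Big(\hat r_i^j+\sum_{k\ne i}\langle\hat q_{ik}^j,x_k\rangle-\tau\ln x_i^j+\tau\ln\big(1-\sum_{\ell=1}^{n_i}x_i^\ell\big)\Big)^2.$$ Here $\nabla$ is the full gradient with respect to $x=(x_1,\dots,x_N)\in\mathbb{R}^{\sum_i n_i}$. With $M=\max_{i\in[N]}(n_i+1)$, the constraint set is $\hat{\Delta}^{\tau}=\prod_{i=1}^N\hat{\Delta}_i^{\tau}$, where $$\hat{\Delta}_i^{\tau}=\Big\{x_i\in\mathbb{R}^{n_i}: x_i^j\ge\frac{e^{-1/\tau^2}}{M}\ \forall j\in[n_i],\ \ \sum_{j=1}^{n_i}x_i^j\le 1-\frac{e^{-1/\tau^{1.5}}}{M}\Big\}.$$ *)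

theory Defs
  imports "HOL-Analysis.Analysis"
begin

text \<open>
  A profile is a function \<open>x :: nat \<Rightarrow> nat \<Rightarrow> real\<close>, where \<open>x i j\<close> is the coordinate \<open>j\<close>
  of player \<open>i\<close>; only the entries with \<open>i \<in> {1..N}\<close> and \<open>j\<close> in the range belonging to
  player \<open>i\<close> are meaningful, and the other entries are neither constrained nor read.
  \<open>Q i k a b\<close> is the entry \<open>(a, b)\<close> of the matrix \<open>Q\<^sub>i\<^sub>k\<close>.
\<close>

definition action_simplex :: "nat \<Rightarrow> (nat \<Rightarrow> real) set" where
  "action_simplex m = {v. (\<forall>j\<in>{1..m + 1}. 0 \<le> v j) \<and> (\<Sum>j = 1..m + 1. v j) = 1}"

definition profiles :: "nat \<Rightarrow> (nat \<Rightarrow> nat) \<Rightarrow> (nat \<Rightarrow> nat \<Rightarrow> real) set" where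
  "profiles N n = (\<Pi> i\<in>{1..N}. action_simplex (n i))"

definition utility ::
  "nat \<Rightarrow> (nat \<Rightarrow> nat) \<Rightarrow> (nat \<Rightarrow> nat \<Rightarrow> nat \<Rightarrow> nat \<Rightarrow> real) \<Rightarrow> (nat \<Rightarrow> nat \<Rightarrow> real)
    \<Rightarrow> nat \<Rightarrow> (nat \<Rightarrow> nat \<Rightarrow> real) \<Rightarrow> real" where
  "utility N n Q r i x =
     (\<Sum>k\<in>{1..N} - {i}. \<Sum>a = 1..n i + 1. \<Sum>b = 1..n k + 1. x i a * Q i k a b * x k b)
     + (\<Sum>j = 1..N. \<Sum>a = 1..n j + 1. r j a * x j a)"

text \<open>
  The suprema and infima below are attained, since utilities are continuous in finitely many
  coordinates ranging over a nonempty compact set.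
\<close>

definition utility_range ::
  "nat \<Rightarrow> (nat \<Rightarrow> nat) \<Rightarrow> (nat \<Rightarrow> nat \<Rightarrow> nat \<Rightarrow> nat \<Rightarrow> real) \<Rightarrow> (nat \<Rightarrow> nat \<Rightarrow> real) \<Rightarrow> real" where
  "utility_range N n Q r =
     Max ((\<lambda>i. (SUP x\<in>profiles N n. utility N n Q r i x)
              - (INF x\<in>profiles N n. utility N n Q r i x)) ` {1..N})"

definition lift_profile :: "(nat \<Rightarrow> nat) \<Rightarrow> (nat \<Rightarrow> nat \<Rightarrow> real) \<Rightarrow> nat \<Rightarrow> nat \<Rightarrow> real" where
  "lift_profile n x = (\<lambda>k j. if j = n k + 1 then 1 - (\<Sum>l = 1..n k. x k l) else x k j)"

definition utility_t ::
  "nat \<Rightarrow> (nat \<Rightarrow> nat) \<Rightarrow> (nat \<Rightarrow> nat \<Rightarrow> nat \<Rightarrow> nat \<Rightarrow> real) \<Rightarrow> (nat \<Rightarrow> nat \<Rightarrow> real)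
    \<Rightarrow> nat \<Rightarrow> (nat \<Rightarrow> nat \<Rightarrow> real) \<Rightarrow> real" where
  "utility_t N n Q r i x = utility N n Q r i (lift_profile n x)"

text \<open>The real function obtained by varying only the coordinate \<open>(k, m)\<close>.\<close>

definition slice ::
  "((nat \<Rightarrow> nat \<Rightarrow> real) \<Rightarrow> real) \<Rightarrow> (nat \<Rightarrow> nat \<Rightarrow> real) \<Rightarrow> nat \<Rightarrow> nat \<Rightarrow> real \<Rightarrow> real" where
  "slice F x k m s = F (x(k := (x k)(m := s)))"

text \<open>
  The gradient with respect to all coordinates, as the family of partial derivatives, which
  are required to exist.
\<close>

definition has_gradient ::
  "nat \<Rightarrow> (nat \<Rightarrow> nat) \<Rightarrow> ((nat \<Rightarrow> nat \<Rightarrow> real) \<Rightarrow> real) \<Rightarrow> (nat \<Rightarrow> nat \<Rightarrow> real)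
    \<Rightarrow> (nat \<Rightarrow> nat \<Rightarrow> real) \<Rightarrow> bool" where
  "has_gradient N n F x G \<longleftrightarrow>
     (\<forall>k\<in>{1..N}. \<forall>m\<in>{1..n k}. (slice F x k m has_real_derivative G k m) (at (x k m)))"

text \<open>
  The coefficients of the affine function \<open>\<partial>f\<^sub>i\<^sup>t / \<partial>x\<^sub>i\<^sup>j\<close>; lemma \<open>utility_t_partial\<close> below
  confirms the formulas.
\<close>

definition r_hat ::
  "nat \<Rightarrow> (nat \<Rightarrow> nat) \<Rightarrow> (nat \<Rightarrow> nat \<Rightarrow> nat \<Rightarrow> nat \<Rightarrow> real) \<Rightarrow> (nat \<Rightarrow> nat \<Rightarrow> real)
    \<Rightarrow> nat \<Rightarrow> nat \<Rightarrow> real" where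
  "r_hat N n Q r i j =
     r i j - r i (n i + 1)
     + (\<Sum>k\<in>{1..N} - {i}. Q i k j (n k + 1) - Q i k (n i + 1) (n k + 1))"

definition q_hat ::
  "(nat \<Rightarrow> nat) \<Rightarrow> (nat \<Rightarrow> nat \<Rightarrow> nat \<Rightarrow> nat \<Rightarrow> real) \<Rightarrow> nat \<Rightarrow> nat \<Rightarrow> nat \<Rightarrow> nat \<Rightarrow> real" where
  "q_hat n Q i k j m =
     Q i k j m - Q i k (n i + 1) m - Q i k j (n k + 1) + Q i k (n i + 1) (n k + 1)"

lemma utility_t_partial:
  assumes i: "i \<in> {1..N}" and j: "j \<in> {1..n i}"
  shows "(slice (utility_t N n Q r i) x i j has_real_derivative
           r_hat N n Q r i j + (\<Sum>k\<in>{1..N} - {i}. \<Sum>m = 1..n k. q_hat n Q i k j m * x k m))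
         (at (x i j))"
proof -
  define w where "w = (\<lambda>s. lift_profile n (x(i := (x i)(j := s))))"
  define d where "d = (\<lambda>a. if a = n i + 1 then - 1 else if a = j then 1 else (0::real))"
  have w_other: "w s k b = lift_profile n x k b" if "k \<noteq> i" for s k b
    using that by (simp add: w_def lift_profile_def)
  have sum_upd: "(\<Sum>l = 1..n i. ((x i)(j := s)) l) = s + (\<Sum>l\<in>{1..n i} - {j}. x i l)" for s
    using j by (subst sum.remove[of _ j]) (auto intro!: sum.cong)
  have w_own: "((\<lambda>s. w s i a) has_real_derivative d a) (at (x i j))" for a
  proof -
    define C where "C = (\<Sum>l\<in>{1..n i} - {j}. x i l)"
    have "(\<lambda>s. w s i a)
        = (\<lambda>s. if a = n i + 1 then 1 - (s + C) else if a = j then s else x i a)"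
      unfolding w_def lift_profile_def C_def fun_upd_same sum_upd by (auto simp: fun_eq_iff)
    then show ?thesis
      by (auto simp: d_def intro!: derivative_eq_intros)
  qed
  have d_sum: "(\<Sum>a = 1..n i + 1. d a * c a) = c j - c (n i + 1)" for c :: "nat \<Rightarrow> real"
  proof -
    have "(\<Sum>a = 1..n i. d a * c a) = (\<Sum>a = 1..n i. if a = j then c a else 0)"
      by (rule sum.cong) (auto simp: d_def)
    also have "\<dots> = c j" using j by simp
    finally show ?thesis by (simp add: d_def)
  qed
  have lift_sum: "(\<Sum>b = 1..n k + 1. c b * lift_profile n x k b)
      = c (n k + 1) + (\<Sum>b = 1..n k. (c b - c (n k + 1)) * x k b)" for c k
  proof -
    have "(\<Sum>b = 1..n k. c b * lift_profile n x k b) = (\<Sum>b = 1..n k. c b * x k b)"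
      by (rule sum.cong) (auto simp: lift_profile_def)
    then show ?thesis
      by (simp add: lift_profile_def algebra_simps sum_subtractf sum_distrib_left)
  qed
  have quad: "((\<lambda>s. \<Sum>k\<in>{1..N} - {i}. \<Sum>a = 1..n i + 1. \<Sum>b = 1..n k + 1.
                 w s i a * Q i k a b * w s k b) has_real_derivative
      (\<Sum>k\<in>{1..N} - {i}. \<Sum>a = 1..n i + 1. \<Sum>b = 1..n k + 1.
                 d a * Q i k a b * lift_profile n x k b)) (at (x i j))"
  proof (intro DERIV_sum)
    fix k a b assume "k \<in> {1..N} - {i}"
    then have "k \<noteq> i" by simp
    then show "((\<lambda>s. w s i a * Q i k a b * w s k b) has_real_derivative
                 d a * Q i k a b * lift_profile n x k b) (at (x i j))"
      using DERIV_cmult_right[OF w_own[of a], of "Q i k a b * lift_profile n x k b"]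
      by (simp add: w_other mult.assoc)
  qed
  have lin: "((\<lambda>s. \<Sum>k = 1..N. \<Sum>a = 1..n k + 1. r k a * w s k a) has_real_derivative
      (\<Sum>k = 1..N. \<Sum>a = 1..n k + 1. r k a * (if k = i then d a else 0))) (at (x i j))"
  proof (intro DERIV_sum DERIV_cmult)
    fix k a
    show "((\<lambda>s. w s k a) has_real_derivative (if k = i then d a else 0)) (at (x i j))"
      using w_own[of a] by (cases "k = i") (simp_all add: w_other)
  qed
  have lin_val: "(\<Sum>k = 1..N. \<Sum>a = 1..n k + 1. r k a * (if k = i then d a else 0))
      = r i j - r i (n i + 1)"
  proof -
    have "(\<Sum>k = 1..N. \<Sum>a = 1..n k + 1. r k a * (if k = i then d a else 0))
        = (\<Sum>k = 1..N. if k = i then (\<Sum>a = 1..n i + 1. d a * r i a) else 0)"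
      by (rule sum.cong) (auto simp: mult.commute)
    also have "\<dots> = (\<Sum>a = 1..n i + 1. d a * r i a)" using i by simp
    finally show ?thesis using d_sum[of "r i"] by simp
  qed
  have quad_val: "(\<Sum>a = 1..n i + 1. \<Sum>b = 1..n k + 1. d a * Q i k a b * lift_profile n x k b)
      = (Q i k j (n k + 1) - Q i k (n i + 1) (n k + 1))
        + (\<Sum>m = 1..n k. q_hat n Q i k j m * x k m)" for k
  proof -
    have "(\<Sum>a = 1..n i + 1. \<Sum>b = 1..n k + 1. d a * Q i k a b * lift_profile n x k b)
        = (\<Sum>a = 1..n i + 1. d a * (\<Sum>b = 1..n k + 1. Q i k a b * lift_profile n x k b))"
      by (simp only: sum_distrib_left mult.assoc)
    also have "\<dots> = (\<Sum>b = 1..n k + 1. Q i k j b * lift_profile n x k b)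
        - (\<Sum>b = 1..n k + 1. Q i k (n i + 1) b * lift_profile n x k b)"
      by (rule d_sum)
    also have "\<dots> = (\<Sum>b = 1..n k + 1. (Q i k j b - Q i k (n i + 1) b) * lift_profile n x k b)"
      by (simp only: sum_subtractf left_diff_distrib)
    also have "\<dots> = (Q i k j (n k + 1) - Q i k (n i + 1) (n k + 1))
        + (\<Sum>m = 1..n k. q_hat n Q i k j m * x k m)"
      by (subst lift_sum) (simp add: q_hat_def algebra_simps)
    finally show ?thesis .
  qed
  have slice_eq: "slice (utility_t N n Q r i) x i j = (\<lambda>s.
      (\<Sum>k\<in>{1..N} - {i}. \<Sum>a = 1..n i + 1. \<Sum>b = 1..n k + 1. w s i a * Q i k a b * w s k b)
      + (\<Sum>k = 1..N. \<Sum>a = 1..n k + 1. r k a * w s k a))"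
    by (simp only: slice_def utility_t_def utility_def w_def fun_eq_iff simp_thms)
  have val: "(\<Sum>k\<in>{1..N} - {i}. (Q i k j (n k + 1) - Q i k (n i + 1) (n k + 1))
        + (\<Sum>m = 1..n k. q_hat n Q i k j m * x k m)) + (r i j - r i (n i + 1))
      = r_hat N n Q r i j + (\<Sum>k\<in>{1..N} - {i}. \<Sum>m = 1..n k. q_hat n Q i k j m * x k m)"
    unfolding r_hat_def sum.distrib by simp
  show ?thesis
    using DERIV_add[OF quad lin] unfolding lin_val quad_val val slice_eq .
qed

definition loss ::
  "nat \<Rightarrow> (nat \<Rightarrow> nat) \<Rightarrow> (nat \<Rightarrow> nat \<Rightarrow> nat \<Rightarrow> nat \<Rightarrow> real) \<Rightarrow> (nat \<Rightarrow> nat \<Rightarrow> real)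
    \<Rightarrow> real \<Rightarrow> nat \<Rightarrow> nat \<Rightarrow> (nat \<Rightarrow> nat \<Rightarrow> real) \<Rightarrow> real" where
  "loss N n Q r \<tau> i j x =
     (r_hat N n Q r i j + (\<Sum>k\<in>{1..N} - {i}. \<Sum>m = 1..n k. q_hat n Q i k j m * x k m)
      - \<tau> * ln (x i j) + \<tau> * ln (1 - (\<Sum>l = 1..n i. x i l)))\<^sup>2"

definition max_actions :: "nat \<Rightarrow> (nat \<Rightarrow> nat) \<Rightarrow> nat" where
  "max_actions N n = Max ((\<lambda>i. n i + 1) ` {1..N})"

definition constr_set :: "nat \<Rightarrow> (nat \<Rightarrow> nat) \<Rightarrow> real \<Rightarrow> (nat \<Rightarrow> nat \<Rightarrow> real) set" where
  "constr_set N n \<tau> = (\<Pi> i\<in>{1..N}. {v.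
     (\<forall>j\<in>{1..n i}. exp (- (1 / \<tau>\<^sup>2)) / real (max_actions N n) \<le> v j) \<and>
     (\<Sum>j = 1..n i. v j) \<le> 1 - exp (- (1 / \<tau> powr (3 / 2))) / real (max_actions N n)})"

definition loss_min ::
  "nat \<Rightarrow> (nat \<Rightarrow> nat) \<Rightarrow> (nat \<Rightarrow> nat \<Rightarrow> nat \<Rightarrow> nat \<Rightarrow> real) \<Rightarrow> (nat \<Rightarrow> nat \<Rightarrow> real)
    \<Rightarrow> real \<Rightarrow> nat \<Rightarrow> nat \<Rightarrow> real" where
  "loss_min N n Q r \<tau> i j = (INF y\<in>constr_set N n \<tau>. loss N n Q r \<tau> i j y)"

end

theory Submission imports Defs begin

text \<open>
  The loss is the square of a residual \<open>g\<close>, namely the marginal utility of the action \<open>j\<close> of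
  player \<open>i\<close> relative to the last action, minus \<open>\<tau>\<close> times the log-ratio of the probabilities
  of these two actions. Hence \<open>\<nabla>l = 2 g \<nabla>g\<close>. The marginal utility does not depend on the strategy
  of player \<open>i\<close>, so the derivative of \<open>g\<close> in the coordinate \<open>(i, j)\<close> is
  \<open>- \<tau> / x\<^sub>i\<^sup>j - \<tau> / (1 - \<Sum>\<^sub>l x\<^sub>i\<^sup>l)\<close>, which is negative on the constraint set
  (\<open>has_derivative_residual_slice\<close>). Therefore \<open>\<nabla>l = 0\<close> exactly where \<open>g = 0\<close>, that is, where the loss
  has the value \<open>0\<close>.

  What remains is that this value is attained in the constraint set (\<open>residual_zero_exists\<close>).
  Fix the strategies of the opponents and let \<open>A\<close> be the marginal utility, which is the difference
  of the payoffs of two pure actions, so that \<open>\<bar>A\<bar> \<le> \<delta>\<^sub>f\<close> (\<open>marginal_abs_le_utility_range\<close>).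
  The equation \<open>g = 0\<close> asks that the action \<open>j\<close> be \<open>\<rho> = exp (A / \<tau>)\<close> times as likely as the last
  one. Player \<open>i\<close> achieves this by playing every action other than \<open>j\<close>, the last one included, with
  the probability \<open>1 / (n\<^sub>i + \<rho>)\<close>, and \<open>j\<close> with the probability \<open>\<rho> / (n\<^sub>i + \<rho>)\<close>. The bounds on \<open>\<tau>\<close> give \<open>\<delta>\<^sub>f / \<tau> \<le> 1 / \<tau>\<^sup>2\<close> and \<open>\<delta>\<^sub>f / \<tau> \<le> 1 / \<tau>\<^bsup>3/2\<^esup>\<close>
  (\<open>temperature_bounds\<close>), so both \<open>\<rho>\<close> and \<open>1 / \<rho>\<close> are at least each of \<open>exp (- 1 / \<tau>\<^sup>2)\<close> and
  \<open>exp (- 1 / \<tau>\<^bsup>3/2\<^esup>)\<close>. These numbers, divided by \<open>M\<close>, are the margins that the constraint set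
  requires for the first \<open>n\<^sub>i\<close> actions and for the last one, and the chosen strategy respects
  them (\<open>tilted_uniform_ge\<close>).
\<close>

section \<open>Marginal utilities are bounded by the utility range\<close>

lemma lift_profile_in_profiles:
  assumes "\<And>k m. k \<in> {1..N} \<Longrightarrow> m \<in> {1..n k} \<Longrightarrow> 0 \<le> x k m"
    and "\<And>k. k \<in> {1..N} \<Longrightarrow> (\<Sum>m = 1..n k. x k m) \<le> 1"
  shows "lift_profile n x \<in> profiles N n"
  unfolding profiles_def action_simplex_def
proof (intro Pi_I CollectI conjI ballI)
  fix k m assume k: "k \<in> {1..N}" and m: "m \<in> {1..n k + 1}"
  show "0 \<le> lift_profile n x k m"
    using assms(1)[OF k, of m] assms(2)[OF k] m by (auto simp: lift_profile_def)
next
  fix k assume k: "k \<in> {1..N}"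
  have "(\<Sum>m = 1..n k. lift_profile n x k m) = (\<Sum>m = 1..n k. x k m)"
    by (rule sum.cong) (auto simp: lift_profile_def)
  then show "(\<Sum>m = 1..n k + 1. lift_profile n x k m) = 1"
    by (simp add: lift_profile_def)
qed

lemma profiles_abs_le_1:
  assumes x: "x \<in> profiles N n" and k: "k \<in> {1..N}" and m: "m \<in> {1..n k + 1}"
  shows "\<bar>x k m\<bar> \<le> 1"
proof -
  have x_nonneg: "0 \<le> x k l" if "l \<in> {1..n k + 1}" for l
    using x k that unfolding profiles_def action_simplex_def by fastforce
  have "(\<Sum>l = 1..n k + 1. x k l) = 1"
    using x k unfolding profiles_def action_simplex_def by fastforce
  moreover have "x k m \<le> (\<Sum>l = 1..n k + 1. x k l)"
    using m x_nonneg by (intro member_le_sum) auto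
  ultimately show ?thesis using x_nonneg[OF m] by simp
qed

text \<open>
  The supremum and infimum in the utility range bound the utility only because it is bounded on the
  profiles.
\<close>

lemma utility_bounded_on_profiles:
  assumes i: "i \<in> {1..N}"
  obtains B where "\<And>x. x \<in> profiles N n \<Longrightarrow> \<bar>utility N n Q r i x\<bar> \<le> B"
proof
  fix x assume x: "x \<in> profiles N n"
  have x_le: "\<bar>x k a\<bar> \<le> 1" if "k \<in> {1..N}" "a \<in> {1..n k + 1}" for k a
    using profiles_abs_le_1[OF x that] .
  have "\<bar>\<Sum>k\<in>{1..N} - {i}. \<Sum>a = 1..n i + 1. \<Sum>b = 1..n k + 1. x i a * Q i k a b * x k b\<bar>
      \<le> (\<Sum>k\<in>{1..N} - {i}. \<Sum>a = 1..n i + 1. \<Sum>b = 1..n k + 1. \<bar>Q i k a b\<bar>)"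
  proof (rule order_trans[OF sum_abs sum_mono], rule order_trans[OF sum_abs sum_mono],
      rule order_trans[OF sum_abs sum_mono])
    fix k a b
    assume "k \<in> {1..N} - {i}" "a \<in> {1..n i + 1}" "b \<in> {1..n k + 1}"
    then have "\<bar>x i a\<bar> * \<bar>x k b\<bar> \<le> 1"
      using x_le i by (intro mult_le_one) auto
    then have "\<bar>Q i k a b\<bar> * (\<bar>x i a\<bar> * \<bar>x k b\<bar>) \<le> \<bar>Q i k a b\<bar>"
      by (rule mult_left_le) simp
    then show "\<bar>x i a * Q i k a b * x k b\<bar> \<le> \<bar>Q i k a b\<bar>"
      by (simp add: abs_mult mult_ac)
  qed
  moreover have "\<bar>\<Sum>k = 1..N. \<Sum>a = 1..n k + 1. r k a * x k a\<bar>
      \<le> (\<Sum>k = 1..N. \<Sum>a = 1..n k + 1. \<bar>r k a\<bar>)"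
  proof (rule order_trans[OF sum_abs sum_mono], rule order_trans[OF sum_abs sum_mono])
    fix k a assume "k \<in> {1..N}" "a \<in> {1..n k + 1}"
    then show "\<bar>r k a * x k a\<bar> \<le> \<bar>r k a\<bar>"
      unfolding abs_mult using x_le by (intro mult_left_le) auto
  qed
  ultimately show "\<bar>utility N n Q r i x\<bar>
      \<le> (\<Sum>k\<in>{1..N} - {i}. \<Sum>a = 1..n i + 1. \<Sum>b = 1..n k + 1. \<bar>Q i k a b\<bar>)
        + (\<Sum>k = 1..N. \<Sum>a = 1..n k + 1. \<bar>r k a\<bar>)"
    unfolding utility_def by linarith
qed

lemma utility_diff_le_utility_range:
  assumes i: "i \<in> {1..N}" and x: "x \<in> profiles N n" and y: "y \<in> profiles N n"
  shows "utility N n Q r i x - utility N n Q r i y \<le> utility_range N n Q r"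
proof -
  obtain B where B: "\<And>z. z \<in> profiles N n \<Longrightarrow> \<bar>utility N n Q r i z\<bar> \<le> B"
    using utility_bounded_on_profiles[OF i] by blast
  have "bdd_above (utility N n Q r i ` profiles N n)"
    using B by (intro bdd_aboveI2[of _ _ B]) (simp add: abs_le_iff)
  moreover have "bdd_below (utility N n Q r i ` profiles N n)"
    using B by (intro bdd_belowI2[of _ "- B"]) (fastforce simp: abs_le_iff)
  ultimately have "utility N n Q r i x - utility N n Q r i y
      \<le> (SUP z\<in>profiles N n. utility N n Q r i z) - (INF z\<in>profiles N n. utility N n Q r i z)"
    using x y by (intro diff_mono cSUP_upper cINF_lower) auto
  also have "\<dots> \<le> utility_range N n Q r"
    unfolding utility_range_def using i by (intro Max_ge) auto
  finally show ?thesis .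
qed

definition marginal ::
  "nat \<Rightarrow> (nat \<Rightarrow> nat) \<Rightarrow> (nat \<Rightarrow> nat \<Rightarrow> nat \<Rightarrow> nat \<Rightarrow> real) \<Rightarrow> (nat \<Rightarrow> nat \<Rightarrow> real)
    \<Rightarrow> nat \<Rightarrow> nat \<Rightarrow> (nat \<Rightarrow> nat \<Rightarrow> real) \<Rightarrow> real" where
  "marginal N n Q r i j x =
     r_hat N n Q r i j + (\<Sum>k\<in>{1..N} - {i}. \<Sum>m = 1..n k. q_hat n Q i k j m * x k m)"

lemma marginal_update_own: "marginal N n Q r i j (x(i := v)) = marginal N n Q r i j x"
  unfolding marginal_def by (intro arg_cong2[of _ _ _ _ "(+)"] sum.cong) auto

text \<open>
  The marginal utility is the derivative of the utility in the coordinate \<open>(i, j)\<close>, and it is constant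
  in the strategy of player \<open>i\<close>. So it equals the increment of the utility along the edge of the
  simplex from the last pure action, which is the origin in the reduced coordinates, to the
  pure action \<open>j\<close>.
\<close>

lemma marginal_eq_pure_action_difference:
  assumes i: "i \<in> {1..N}" and j: "j \<in> {1..n i}"
  shows "utility_t N n Q r i (x(i := (\<lambda>_. 0)(j := 1))) - utility_t N n Q r i (x(i := (\<lambda>_. 0)))
    = marginal N n Q r i j x"
proof -
  define h where "h = slice (utility_t N n Q r i) (x(i := (\<lambda>_. 0))) i j"
  have deriv: "(h has_real_derivative marginal N n Q r i j x) (at s)" for s
  proof -
    define y where "y = x(i := (\<lambda>_. 0)(j := s))"
    have "slice (utility_t N n Q r i) y i j = h"
      by (simp add: h_def y_def slice_def fun_eq_iff)
    moreover have "y i j = s" by (simp add: y_def)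
    moreover have "marginal N n Q r i j y = marginal N n Q r i j x"
      unfolding y_def by (rule marginal_update_own)
    ultimately show ?thesis
      using utility_t_partial[where n = n and x = y and Q = Q and r = r, OF i j]
      by (simp add: marginal_def)
  qed
  have "h 1 - h 0 = marginal N n Q r i j x"
    using MVT2[of 0 1 h "\<lambda>_. marginal N n Q r i j x"] deriv by auto
  moreover have "(\<lambda>_. 0::real)(j := 0) = (\<lambda>_. 0)" by auto
  ultimately show ?thesis by (simp add: h_def slice_def)
qed

lemma marginal_abs_le_utility_range:
  assumes i: "i \<in> {1..N}" and j: "j \<in> {1..n i}"
    and nonneg: "\<And>k m. k \<in> {1..N} \<Longrightarrow> m \<in> {1..n k} \<Longrightarrow> 0 \<le> x k m"
    and sum_le: "\<And>k. k \<in> {1..N} \<Longrightarrow> (\<Sum>m = 1..n k. x k m) \<le> 1"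
  shows "\<bar>marginal N n Q r i j x\<bar> \<le> utility_range N n Q r"
proof -
  have "lift_profile n (x(i := (\<lambda>_. 0)(j := 1))) \<in> profiles N n"
    using nonneg sum_le j by (intro lift_profile_in_profiles) auto
  moreover have "lift_profile n (x(i := (\<lambda>_. 0))) \<in> profiles N n"
    using nonneg sum_le by (intro lift_profile_in_profiles) auto
  ultimately show ?thesis
    using utility_diff_le_utility_range[OF i, where Q = Q and r = r]
      marginal_eq_pure_action_difference[where n = n and x = x and Q = Q and r = r, OF i j]
    unfolding utility_t_def abs_le_iff by (metis minus_diff_eq)
qed

section \<open>A zero of the residual in the constraint set\<close>

text \<open>
  The bound \<open>1 / \<delta>\<close> on the temperature gives the quadratic exponent. The bound \<open>1 / \<delta>\<^sup>2\<close> means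
  \<open>\<delta> \<surd>\<tau> \<le> 1\<close>, which gives the exponent \<open>3/2\<close>.
\<close>

lemma temperature_bounds:
  fixes \<tau> \<delta> :: real
  assumes \<tau>: "0 < \<tau>" and \<delta>: "0 \<le> \<delta>"
    and le: "ereal \<tau> \<le> min (1 / ereal \<delta>) (1 / (ereal \<delta>)\<^sup>2)"
  shows "\<delta> / \<tau> \<le> 1 / \<tau>\<^sup>2" and "\<delta> / \<tau> \<le> 1 / \<tau> powr (3 / 2)"
proof -
  have "\<delta> * \<tau> \<le> 1 \<and> \<delta>\<^sup>2 * \<tau> \<le> 1"
  proof (cases "\<delta> = 0")
    \<comment> \<open>For \<open>\<delta> = 0\<close> both extended reals in \<open>le\<close> are \<open>\<infinity>\<close>, but the two products vanish.\<close>
    case False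
    then have "\<delta> > 0" using \<delta> by simp
    then have "\<tau> \<le> 1 / \<delta>" "\<tau> \<le> 1 / \<delta>\<^sup>2"
      using le by (auto simp: one_ereal_def power2_eq_square)
    then show ?thesis using \<open>\<delta> > 0\<close> by (simp add: field_simps)
  qed simp
  then have first: "\<delta> * \<tau> \<le> 1" and second: "\<delta>\<^sup>2 * \<tau> \<le> 1" by auto
  show "\<delta> / \<tau> \<le> 1 / \<tau>\<^sup>2"
    using first \<tau> by (simp add: field_simps power2_eq_square)
  have "(\<delta> * sqrt \<tau>)\<^sup>2 \<le> 1\<^sup>2"
    using second \<tau> by (simp add: power_mult_distrib)
  then have "\<delta> * sqrt \<tau> \<le> 1" by (rule power2_le_imp_le) simp
  moreover have "\<tau> powr (3 / 2) = \<tau> * sqrt \<tau>"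
    using powr_add[of \<tau> 1 "1 / 2"] \<tau> by (simp add: powr_half_sqrt)
  ultimately show "\<delta> / \<tau> \<le> 1 / \<tau> powr (3 / 2)"
    using \<tau> by (simp add: field_simps)
qed

lemma max_actions_ge: "i \<in> {1..N} \<Longrightarrow> n i + 1 \<le> max_actions N n"
  unfolding max_actions_def by (intro Max_ge) auto

lemma constr_set_interior:
  assumes x: "x \<in> constr_set N n \<tau>" and k: "k \<in> {1..N}"
  shows "m \<in> {1..n k} \<Longrightarrow> 0 < x k m" and "(\<Sum>m = 1..n k. x k m) < 1"
proof -
  have M: "0 < real (max_actions N n)" using max_actions_ge[OF k, of n] by simp
  have "exp (- (1 / \<tau>\<^sup>2)) / real (max_actions N n) \<le> x k m" if "m \<in> {1..n k}"
    using x k that unfolding constr_set_def by fastforce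
  then show "0 < x k m" if "m \<in> {1..n k}"
    using M that by (meson divide_pos_pos exp_gt_zero less_le_trans)
  have "(\<Sum>m = 1..n k. x k m) \<le> 1 - exp (- (1 / \<tau> powr (3 / 2))) / real (max_actions N n)"
    using x k unfolding constr_set_def by fastforce
  moreover have "0 < exp (- (1 / \<tau> powr (3 / 2))) / real (max_actions N n)"
    using M by simp
  ultimately show "(\<Sum>m = 1..n k. x k m) < 1" by linarith
qed

definition residual ::
  "nat \<Rightarrow> (nat \<Rightarrow> nat) \<Rightarrow> (nat \<Rightarrow> nat \<Rightarrow> nat \<Rightarrow> nat \<Rightarrow> real) \<Rightarrow> (nat \<Rightarrow> nat \<Rightarrow> real)
    \<Rightarrow> real \<Rightarrow> nat \<Rightarrow> nat \<Rightarrow> (nat \<Rightarrow> nat \<Rightarrow> real) \<Rightarrow> real" where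
  "residual N n Q r \<tau> i j x =
     marginal N n Q r i j x - \<tau> * ln (x i j) + \<tau> * ln (1 - (\<Sum>l = 1..n i. x i l))"

lemma loss_eq_residual_square: "loss N n Q r \<tau> i j x = (residual N n Q r \<tau> i j x)\<^sup>2"
  by (simp add: loss_def residual_def marginal_def)

text \<open>
  These are the probabilities when one action has the weight \<open>\<rho>\<close> and each of \<open>p\<close> further actions
  has the weight \<open>1\<close>. At \<open>\<rho> = 1\<close> they are uniform, \<open>1 / (p + 1)\<close>; a change of \<open>\<rho>\<close> lowers no
  probability by more than the factor \<open>min \<rho> (1 / \<rho>)\<close>, which is at least \<open>\<theta>\<close>.
\<close>

lemma tilted_uniform_ge:
  fixes \<rho> \<theta> p M :: real
  assumes "0 < \<rho>" "0 < \<theta>" "\<theta> \<le> 1" "\<theta> \<le> \<rho>" "\<theta> * \<rho> \<le> 1" "0 \<le> p" "p + 1 \<le> M"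
  shows "\<theta> / M \<le> 1 / (p + \<rho>)" and "\<theta> / M \<le> \<rho> / (p + \<rho>)"
proof -
  have "\<theta> * (p + \<rho>) \<le> p + 1"
    using mult_right_mono[of \<theta> 1 p] assms by (simp add: algebra_simps)
  then show "\<theta> / M \<le> 1 / (p + \<rho>)"
    using assms by (simp add: field_simps)
  have "\<theta> * p \<le> \<rho> * p" "\<theta> * \<rho> \<le> 1 * \<rho>"
    using assms by (auto intro!: mult_right_mono)
  then have "\<theta> * (p + \<rho>) \<le> \<rho> * (p + 1)"
    by (simp add: algebra_simps)
  also have "\<dots> \<le> \<rho> * M" using assms by simp
  finally show "\<theta> / M \<le> \<rho> / (p + \<rho>)"
    using assms by (simp add: field_simps)
qed

text \<open>
  Only the strategy of player \<open>i\<close> is changed, so the given point \<open>x\<close> supplies the strategies of the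
  opponents and their share of the constraints.
\<close>

lemma residual_zero_exists:
  assumes \<tau>: "0 < \<tau>"
    and le: "ereal \<tau> \<le> min (1 / ereal (utility_range N n Q r))
                             (1 / (ereal (utility_range N n Q r))\<^sup>2)"
    and i: "i \<in> {1..N}" and j: "j \<in> {1..n i}"
    and x: "x \<in> constr_set N n \<tau>"
  obtains y where "y \<in> constr_set N n \<tau>" and "residual N n Q r \<tau> i j y = 0"
proof -
  define A where "A = marginal N n Q r i j x"
  define \<rho> where "\<rho> = exp (A / \<tau>)"
  define p where "p = real (n i)"
  define M where "M = real (max_actions N n)"
  define v where "v = (\<lambda>_. 1 / (p + \<rho>))(j := \<rho> / (p + \<rho>))"
  define y where "y = x(i := v)"
  have \<rho>: "0 < \<rho>" and p: "0 \<le> p" by (simp_all add: \<rho>_def p_def)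
  have M: "p + 1 \<le> M" using max_actions_ge[OF i, of n] by (simp add: p_def M_def)
  have A: "\<bar>A\<bar> \<le> utility_range N n Q r"
    unfolding A_def using constr_set_interior[OF x]
    by (intro marginal_abs_le_utility_range i j) (auto intro: less_imp_le)
  \<comment> \<open>Both margins of the constraint set have the form \<open>exp (- c) / M\<close>, where \<open>c\<close> is a bound
    of \<open>\<bar>ln \<rho>\<bar>\<close>.\<close>
  have margin: "exp (- c) / M \<le> 1 / (p + \<rho>) \<and> exp (- c) / M \<le> \<rho> / (p + \<rho>)"
    if c: "utility_range N n Q r / \<tau> \<le> c" for c
  proof -
    have "\<bar>A\<bar> / \<tau> \<le> c"
      using divide_right_mono[OF A, of \<tau>] \<tau> c by simp
    then have "- c \<le> A / \<tau>" "A / \<tau> \<le> c"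
      using \<tau> by (auto simp: field_simps abs_le_iff)
    then have "exp (- c) \<le> \<rho>" "exp (- c) * \<rho> \<le> 1" "exp (- c) \<le> 1"
      by (auto simp: \<rho>_def simp flip: exp_add)
    then show ?thesis
      using tilted_uniform_ge[of \<rho> "exp (- c)" p M] \<rho> p M by simp
  qed
  have range_nonneg: "0 \<le> utility_range N n Q r" using A by linarith
  note bounds = margin[OF temperature_bounds(1)[OF \<tau> range_nonneg le]]
    margin[OF temperature_bounds(2)[OF \<tau> range_nonneg le]]
  have "(\<Sum>l = 1..n i. v l) = \<rho> / (p + \<rho>) + (\<Sum>l\<in>{1..n i} - {j}. 1 / (p + \<rho>))"
    unfolding v_def using j by (subst sum.remove[of _ j]) (auto intro!: sum.cong)
  also have "\<dots> = \<rho> / (p + \<rho>) + (p - 1) / (p + \<rho>)"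
    using j by (simp add: p_def of_nat_diff)
  also have "\<dots> = 1 - 1 / (p + \<rho>)"
    using p \<rho> by (simp add: diff_divide_distrib[symmetric] add_divide_distrib[symmetric]
        divide_eq_eq eq_divide_eq left_diff_distrib)
  finally have v_sum: "(\<Sum>l = 1..n i. v l) = 1 - 1 / (p + \<rho>)" .
  have "y \<in> constr_set N n \<tau>"
    unfolding constr_set_def
  proof (intro Pi_I)
    fix k assume k: "k \<in> {1..N}"
    show "y k \<in> {v. (\<forall>j\<in>{1..n k}. exp (- (1 / \<tau>\<^sup>2)) / real (max_actions N n) \<le> v j) \<and>
        (\<Sum>j = 1..n k. v j) \<le> 1 - exp (- (1 / \<tau> powr (3 / 2))) / real (max_actions N n)}"
    proof (cases "k = i")
      case True
      have "exp (- (1 / \<tau>\<^sup>2)) / M \<le> v l" for l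
        using bounds by (simp add: v_def)
      then show ?thesis
        using bounds v_sum True by (auto simp: y_def M_def)
    next
      case False
      then show ?thesis using x k unfolding constr_set_def y_def by auto
    qed
  qed
  moreover have "residual N n Q r \<tau> i j y = 0"
  proof -
    have "marginal N n Q r i j y = A"
      unfolding y_def A_def by (rule marginal_update_own)
    moreover have "ln (y i j) = A / \<tau> - ln (p + \<rho>)"
      using \<rho> p by (simp add: y_def v_def ln_div) (simp add: \<rho>_def)
    moreover have "ln (1 - (\<Sum>l = 1..n i. y i l)) = - ln (p + \<rho>)"
      using \<rho> p by (simp add: y_def v_sum ln_div del: One_nat_def)
    ultimately show ?thesis
      using \<tau> by (simp add: residual_def right_diff_distrib)
  qed
  ultimately show thesis by (rule that)
qed

section \<open>Stationary points of the loss\<close>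

text \<open>
  The formula covers all coordinates at once: the indicators select the terms in which the
  coordinate \<open>(k, m)\<close> occurs. Its value matters only at \<open>(i, j)\<close>, where the first sum vanishes; at the
  other coordinates it is the existence of the derivative that counts.
\<close>

lemma has_derivative_residual_slice:
  assumes own_pos: "0 < x i j" and sum_less: "(\<Sum>l = 1..n i. x i l) < 1"
  shows "(slice (residual N n Q r \<tau> i j) x k m has_real_derivative
      (\<Sum>k'\<in>{1..N} - {i}. \<Sum>m' = 1..n k'. q_hat n Q i k' j m' * of_bool (k' = k \<and> m' = m))
      - \<tau> * (of_bool (i = k \<and> j = m) / x i j)
      - \<tau> * ((\<Sum>l = 1..n i. of_bool (i = k \<and> l = m)) / (1 - (\<Sum>l = 1..n i. x i l))))
    (at (x k m))"
proof -
  define w where "w = (\<lambda>s. x(k := (x k)(m := s)))"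
  have w_deriv: "((\<lambda>s. w s k' m') has_real_derivative of_bool (k' = k \<and> m' = m)) (at (x k m))"
    for k' m'
    by (cases "k' = k"; cases "m' = m") (simp_all add: w_def)
  have ln_chain: "((\<lambda>s. ln (u s)) has_real_derivative d / u a) (at a)"
    if "(u has_real_derivative d) (at a)" "0 < u a" for u d and a :: real
    using that by (auto intro!: derivative_eq_intros)
  have w_at: "w (x k m) = x" by (simp add: w_def)
  have "((\<lambda>s. \<Sum>k'\<in>{1..N} - {i}. \<Sum>m' = 1..n k'. q_hat n Q i k' j m' * w s k' m')
      has_real_derivative
      (\<Sum>k'\<in>{1..N} - {i}. \<Sum>m' = 1..n k'. q_hat n Q i k' j m' * of_bool (k' = k \<and> m' = m)))
      (at (x k m))"
    by (intro DERIV_sum DERIV_cmult w_deriv)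
  moreover have "((\<lambda>s. ln (w s i j)) has_real_derivative of_bool (i = k \<and> j = m) / x i j)
      (at (x k m))"
    using ln_chain[OF w_deriv[of i j]] own_pos by (simp add: w_at)
  moreover have "((\<lambda>s. \<Sum>l = 1..n i. w s i l) has_real_derivative
      (\<Sum>l = 1..n i. of_bool (i = k \<and> l = m))) (at (x k m))"
    by (intro DERIV_sum w_deriv)
  then have "((\<lambda>s. ln (1 - (\<Sum>l = 1..n i. w s i l))) has_real_derivative
      - ((\<Sum>l = 1..n i. of_bool (i = k \<and> l = m)) / (1 - (\<Sum>l = 1..n i. x i l)))) (at (x k m))"
    using ln_chain[OF DERIV_diff[OF DERIV_const[of 1]]] sum_less
    by (fastforce simp: w_at simp del: One_nat_def sum_of_bool_eq)
  ultimately have "((\<lambda>s. r_hat N n Q r i j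
        + (\<Sum>k'\<in>{1..N} - {i}. \<Sum>m' = 1..n k'. q_hat n Q i k' j m' * w s k' m')
        - \<tau> * ln (w s i j) + \<tau> * ln (1 - (\<Sum>l = 1..n i. w s i l))) has_real_derivative
      (0 + (\<Sum>k'\<in>{1..N} - {i}. \<Sum>m' = 1..n k'. q_hat n Q i k' j m' * of_bool (k' = k \<and> m' = m))
      - \<tau> * (of_bool (i = k \<and> j = m) / x i j)
      + \<tau> * (- ((\<Sum>l = 1..n i. of_bool (i = k \<and> l = m)) / (1 - (\<Sum>l = 1..n i. x i l))))))
    (at (x k m))"
    by (intro DERIV_add DERIV_diff DERIV_cmult DERIV_const)
  moreover have "slice (residual N n Q r \<tau> i j) x k m = (\<lambda>s. r_hat N n Q r i j
        + (\<Sum>k'\<in>{1..N} - {i}. \<Sum>m' = 1..n k'. q_hat n Q i k' j m' * w s k' m')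
        - \<tau> * ln (w s i j) + \<tau> * ln (1 - (\<Sum>l = 1..n i. w s i l)))"
    unfolding slice_def residual_def marginal_def w_def by (rule refl)
  ultimately show ?thesis by simp
qed

text \<open>
  A stationary point is detected by the coordinate \<open>(i, j)\<close> alone, in which the residual is strictly
  decreasing. Conversely, at a zero of the residual the factor \<open>g\<close> in \<open>2 g \<nabla>g\<close> annihilates
  every partial derivative.
\<close>

lemma loss_gradient_zero_iff:
  assumes \<tau>: "0 < \<tau>" and i: "i \<in> {1..N}" and j: "j \<in> {1..n i}"
    and own_pos: "0 < x i j" and sum_less: "(\<Sum>l = 1..n i. x i l) < 1"
  shows "has_gradient N n (loss N n Q r \<tau> i j) x (\<lambda>k m. 0) \<longleftrightarrow> residual N n Q r \<tau> i j x = 0"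
proof
  define g where "g = residual N n Q r \<tau> i j x"
  have loss_deriv: "(slice (loss N n Q r \<tau> i j) x k m has_real_derivative 2 * g * D) (at (x k m))"
    if "(slice (residual N n Q r \<tau> i j) x k m has_real_derivative D) (at (x k m))" for k m D
  proof -
    have "slice (loss N n Q r \<tau> i j) x k m = (\<lambda>s. (slice (residual N n Q r \<tau> i j) x k m s)\<^sup>2)"
      by (simp add: slice_def loss_eq_residual_square fun_eq_iff)
    moreover have "slice (residual N n Q r \<tau> i j) x k m (x k m) = g"
      by (simp add: slice_def g_def)
    ultimately show ?thesis
      using DERIV_power[OF that, of 2] by (simp add: mult_ac)
  qed
  note slice_deriv = has_derivative_residual_slice[where x = x and i = i and j = j and n = n
      and N = N and Q = Q and r = r and \<tau> = \<tau>, OF own_pos sum_less]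
  {
    assume "has_gradient N n (loss N n Q r \<tau> i j) x (\<lambda>k m. 0)"
    then have "(slice (loss N n Q r \<tau> i j) x i j has_real_derivative 0) (at (x i j))"
      using i j by (simp add: has_gradient_def)
    moreover define D where "D = - \<tau> / x i j - \<tau> / (1 - (\<Sum>l = 1..n i. x i l))"
    have "(\<Sum>k'\<in>{1..N} - {i}. \<Sum>m' = 1..n k'.
        q_hat n Q i k' j m' * of_bool (k' = i \<and> m' = j)) = 0"
      by (intro sum.neutral ballI) auto
    moreover have "(\<Sum>l = 1..n i. of_bool (l = j)) = (1 :: real)"
      using j by (simp add: of_bool_def)
    ultimately have "2 * g * D = 0"
      using loss_deriv[OF slice_deriv[of i j]] DERIV_unique by (fastforce simp: D_def)
    moreover have "D < 0"
    proof -
      have "0 < \<tau> / x i j" "0 < \<tau> / (1 - (\<Sum>l = 1..n i. x i l))"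
        using \<tau> own_pos sum_less by simp_all
      then show ?thesis unfolding D_def by simp
    qed
    ultimately show "residual N n Q r \<tau> i j x = 0" by (simp add: g_def)
  }
  assume "residual N n Q r \<tau> i j x = 0"
  then show "has_gradient N n (loss N n Q r \<tau> i j) x (\<lambda>k m. 0)"
    unfolding has_gradient_def using loss_deriv[OF slice_deriv] by (simp add: g_def)
qed

theorem lemma4:
  fixes N :: nat and n :: "nat \<Rightarrow> nat"
    and Q :: "nat \<Rightarrow> nat \<Rightarrow> nat \<Rightarrow> nat \<Rightarrow> real"
    and r :: "nat \<Rightarrow> nat \<Rightarrow> real"
    and \<tau> :: real
    and i j :: nat
    and x :: "nat \<Rightarrow> nat \<Rightarrow> real"
  assumes "\<forall>k\<in>{1..N}. 1 \<le> n k"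
    and "0 < \<tau>"
    and "ereal \<tau> \<le> min (1 / ereal (utility_range N n Q r)) (1 / (ereal (utility_range N n Q r))\<^sup>2)"
    and "i \<in> {1..N}" and "j \<in> {1..n i}"
    and "x \<in> constr_set N n \<tau>"
  shows "(has_gradient N n (loss N n Q r \<tau> i j) x (\<lambda>k m. 0) \<longleftrightarrow>
            is_arg_min (loss N n Q r \<tau> i j) (\<lambda>y. y \<in> constr_set N n \<tau>) x)
       \<and> (is_arg_min (loss N n Q r \<tau> i j) (\<lambda>y. y \<in> constr_set N n \<tau>) x \<longleftrightarrow>
            loss N n Q r \<tau> i j x = loss_min N n Q r \<tau> i j)
       \<and> loss_min N n Q r \<tau> i j \<in> loss N n Q r \<tau> i j ` constr_set N n \<tau>
       \<and> loss_min N n Q r \<tau> i j = 0"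
proof -
  let ?l = "loss N n Q r \<tau> i j" and ?C = "constr_set N n \<tau>"
  have nonneg: "0 \<le> ?l z" for z by (simp add: loss_eq_residual_square)
  obtain y where y: "y \<in> ?C" "?l y = 0"
    using residual_zero_exists[OF assms(2-6)] by (auto simp: loss_eq_residual_square)
  have min: "loss_min N n Q r \<tau> i j = 0"
    unfolding loss_min_def using y nonneg by (intro cInf_eq_minimum) force+
  have "is_arg_min ?l (\<lambda>z. z \<in> ?C) x \<longleftrightarrow> ?l x = 0"
    unfolding is_arg_min_def using y nonneg assms(6)
    by (metis antisym linorder_not_less)
  moreover have "has_gradient N n ?l x (\<lambda>k m. 0) \<longleftrightarrow> ?l x = 0"
    using loss_gradient_zero_iff[where n = n and x = x and Q = Q and r = r, OF assms(2,4,5)]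
      constr_set_interior[OF assms(6,4)] assms(5)
    by (simp add: loss_eq_residual_square)
  ultimately show ?thesis
    using min y by (metis image_eqI)
qed

end
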